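(* Let $Z$ be a classical random variable with values in $\{0,1\}^m$ and let $\{\rho_z\}$ be density matrices on a Hilbert space of dimension $2^d$; consider the cq-state $Z\rho_Z=\sum_z\Pr[Z=z]\,|z\rangle\langle z|\otimes\rho_z$. Then $$\big|Z\rho_Z-U_m\rho_Z\big|_{\mathrm{tr}}^2\le 2^{\min(d,m)}\cdot\sum_{0\ne S\in\{0,1\}^m}\big|(S\cdot Z)\rho_Z-U_1\rho_Z\big|_{\mathrm{tr}}^2 .$$
   Context: For a matrix $A$, $|A|_{\mathrm{tr}}=\frac12\mathrm{Tr}\sqrt{A^\dagger A}$. With $p(z)=\Pr[Z=z]$ and $\rho_Z=\sum_zp(z)\rho_z$: $U_m\rho_Z=2^{-m}\sum_{u\in\{0,1\}^m}|u\rangle\langle u|\otimes\rho_Z$ and $U_1\rho_Z$ is the same with $m=1$. For $S,z\in\{0,1\}^m$, $S\cdot z=\sum_iS_iz_i\bmod 2$, and $(S\cdot Z)\rho_Z=\sum_zp(z)\,|S\cdot z\rangle\langle S\cdot z|\otimes\rho_z$. *)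

theory Defs
  imports "HOL-Probability.Probability_Measure" "Jordan_Normal_Form.Schur_Decomposition"
begin

hide_const (open) Finite_Cartesian_Product.vec Finite_Cartesian_Product.mat
  Finite_Cartesian_Product.row Finite_Cartesian_Product.column Determinants.trace
no_notation vec_nth (infixl \<open>$\<close> 90)
no_notation inner (infix \<open>\<bullet>\<close> 70)

definition mat_trace :: "complex mat \<Rightarrow> complex" where
  "mat_trace A = (\<Sum>i<dim_row A. A $$ (i, i))"

text \<open>The order on the complex numbers is the one of \<^theory>\<open>HOL-Library.Complex_Order\<close>:
  \<open>0 \<le> w\<close> says that \<open>w\<close> is real and nonnegative.\<close>

definition psd_mat :: "nat \<Rightarrow> complex mat \<Rightarrow> bool" where
  "psd_mat n A \<longleftrightarrow> A \<in> carrier_mat n n \<and> mat_adjoint A = A \<and>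
     (\<forall>v\<in>carrier_vec n. 0 \<le> (A *\<^sub>v v) \<bullet>c v)"

definition density_mat :: "nat \<Rightarrow> complex mat \<Rightarrow> bool" where
  "density_mat n \<rho> \<longleftrightarrow> psd_mat n \<rho> \<and> mat_trace \<rho> = 1"

text \<open>A positive semidefinite matrix has exactly one positive semidefinite square root, so for such \<open>A\<close>
  the description below is proper; it is only applied to \<open>mat_adjoint A * A\<close>.\<close>

definition psd_sqrt :: "complex mat \<Rightarrow> complex mat" where
  "psd_sqrt A = (THE B. psd_mat (dim_row A) B \<and> B * B = A)"

definition tr_norm :: "complex mat \<Rightarrow> real" where
  "tr_norm A = Re (mat_trace (psd_sqrt (mat_adjoint A * A))) / 2"

definition kron :: "complex mat \<Rightarrow> complex mat \<Rightarrow> complex mat" (infixr \<open>\<otimes>\<^sub>m\<close> 70) where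
  "A \<otimes>\<^sub>m B = mat (dim_row A * dim_row B) (dim_col A * dim_col B)
     (\<lambda>(i, j). A $$ (i div dim_row B, j div dim_col B) * B $$ (i mod dim_row B, j mod dim_col B))"

definition mat_sum :: "nat \<Rightarrow> ('a \<Rightarrow> complex mat) \<Rightarrow> 'a set \<Rightarrow> complex mat" where
  "mat_sum n f I = mat n n (\<lambda>(i, j). \<Sum>x\<in>I. f x $$ (i, j))"

text \<open>Bits are Booleans, with \<open>True\<close> for 1.\<close>

definition bitstrings :: "nat \<Rightarrow> bool list set" where
  "bitstrings m = {z. length z = m}"

definition bit_dot :: "bool list \<Rightarrow> bool list \<Rightarrow> bool" where
  "bit_dot S z \<longleftrightarrow> odd (\<Sum>i<length S. of_bool (S ! i) * of_bool (z ! i) :: nat)"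

text \<open>\<open>basis_proj z\<close> is \<open>|z><z|\<close>. The basis vector \<open>|z>\<close> is the unit vector whose index is the number
  with binary digits \<open>z\<close>, first bit most significant, which is the Kronecker product of
  the one-bit vectors \<open>|z_1>, ..., |z_m>\<close> in this order.\<close>

definition basis_proj :: "bool list \<Rightarrow> complex mat" where
  "basis_proj z = (let k = horner_sum of_bool 2 (rev z) :: nat in
     mat (2 ^ length z) (2 ^ length z) (\<lambda>(i, j). of_bool (i = k \<and> j = k)))"

text \<open>In the following, \<open>n\<close> is the dimension of the quantum register and \<open>p z\<close> is \<open>Pr[Z = z]\<close>.\<close>

definition cq_state :: "nat \<Rightarrow> nat \<Rightarrow> (bool list \<Rightarrow> real) \<Rightarrow> (bool list \<Rightarrow> complex mat) \<Rightarrow> complex mat" where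
  "cq_state n m p \<rho> =
     mat_sum (2 ^ m * n) (\<lambda>z. complex_of_real (p z) \<cdot>\<^sub>m (basis_proj z \<otimes>\<^sub>m \<rho> z)) (bitstrings m)"

definition avg_state :: "nat \<Rightarrow> nat \<Rightarrow> (bool list \<Rightarrow> real) \<Rightarrow> (bool list \<Rightarrow> complex mat) \<Rightarrow> complex mat" where
  "avg_state n m p \<rho> = mat_sum n (\<lambda>z. complex_of_real (p z) \<cdot>\<^sub>m \<rho> z) (bitstrings m)"

definition uniform_state :: "nat \<Rightarrow> nat \<Rightarrow> complex mat \<Rightarrow> complex mat" where
  "uniform_state n k \<sigma> =
     complex_of_real (1 / 2 ^ k) \<cdot>\<^sub>m mat_sum (2 ^ k * n) (\<lambda>u. basis_proj u \<otimes>\<^sub>m \<sigma>) (bitstrings k)"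

definition dot_state ::
  "nat \<Rightarrow> nat \<Rightarrow> bool list \<Rightarrow> (bool list \<Rightarrow> real) \<Rightarrow> (bool list \<Rightarrow> complex mat) \<Rightarrow> complex mat" where
  "dot_state n m S p \<rho> =
     mat_sum (2 * n) (\<lambda>z. complex_of_real (p z) \<cdot>\<^sub>m (basis_proj [bit_dot S z] \<otimes>\<^sub>m \<rho> z)) (bitstrings m)"

end

theory Submission
  imports Defs "Jordan_Normal_Form.Spectral_Radius"
begin

text \<open>Write \<open>A\<^sub>z = p(z) \<rho>\<^sub>z - 2\<^sup>-\<^sup>m \<sigma>\<close>, where \<open>\<sigma>\<close> is the average state, and let
  \<open>D\<^sub>S = \<Sum>\<^sub>z (-1)\<^bsup>S\<cdot>z\<^esup> A\<^sub>z\<close> be the Fourier transform. Both states on the left are block diagonal,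
  with difference the direct sum of the \<open>A\<^sub>z\<close>; for \<open>S \<noteq> 0\<close> the difference on the right is the
  direct sum of \<open>D\<^sub>S/2\<close> and \<open>-D\<^sub>S/2\<close>. Since \<open>D\<^sub>0 = 0\<close>, Fourier inversion and the triangle
  inequality give \<open>\<Sum>\<^sub>z |A\<^sub>z| \<le> \<Sum>\<^sub>S\<^sub>\<noteq>\<^sub>0 |D\<^sub>S|\<close>, and Cauchy-Schwarz over \<open>S\<close> yields the factor \<open>2\<^sup>m\<close>.
  For the factor \<open>2\<^sup>d\<close>, pass to the Hilbert-Schmidt norm, where Parseval is available: \<open>2|\<cdot>|\<close>
  dominates it and is at most the square root of the dimension times it.\<close>

section \<open>Hermitian matrices\<close>

lemma mat_adjoint_dim [simp]:
  "dim_row (mat_adjoint A) = dim_col A" "dim_col (mat_adjoint A) = dim_row A"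
  by (simp_all add: mat_adjoint_def)

lemma mat_adjoint_carrier [simp]: "A \<in> carrier_mat n k \<Longrightarrow> mat_adjoint A \<in> carrier_mat k n"
  by (intro carrier_matI) (simp_all add: carrier_matD)

lemma mat_adjoint_index [simp]:
  fixes A :: "complex mat"
  shows "i < dim_col A \<Longrightarrow> j < dim_row A \<Longrightarrow> mat_adjoint A $$ (i, j) = cnj (A $$ (j, i))"
  by (simp add: mat_adjoint_def mat_of_rows_def)

lemma mat_adjoint_adjoint [simp]: "mat_adjoint (mat_adjoint A) = (A :: complex mat)"
  by (rule eq_matI) simp_all

lemma mat_adjoint_mult:
  fixes A B :: "complex mat"
  assumes "A \<in> carrier_mat n k" "B \<in> carrier_mat k l"
  shows "mat_adjoint (A * B) = mat_adjoint B * mat_adjoint A"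
  by (rule eq_matI) (use assms in \<open>auto simp: scalar_prod_def mult.commute\<close>)

lemma mat_adjoint_one [simp]: "mat_adjoint (1\<^sub>m n) = (1\<^sub>m n :: complex mat)"
  by (rule eq_matI) auto

lemma mat_adjoint_diag_real [simp]:
  "mat_adjoint (mat_diag n (\<lambda>i. complex_of_real (f i))) = mat_diag n (\<lambda>i. complex_of_real (f i))"
  by (rule eq_matI) (auto simp: mat_diag_def)

lemma mat_diag_dims [simp]: "dim_row (mat_diag n f) = n" "dim_col (mat_diag n f) = n"
  by (simp_all add: mat_diag_def)

lemma hermitian_index:
  fixes A :: "complex mat"
  assumes "mat_adjoint A = A" "A \<in> carrier_mat n n" "i < n" "j < n"
  shows "cnj (A $$ (i, j)) = A $$ (j, i)"
  using assms mat_adjoint_index[of j A i] by auto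

lemma hermitianI:
  assumes "A \<in> carrier_mat n n" "\<And>i j. i < n \<Longrightarrow> j < n \<Longrightarrow> cnj (A $$ (i, j)) = A $$ (j, i)"
  shows "mat_adjoint A = A"
  by (rule eq_matI) (use assms in auto)

lemma cscalar_mult_adjoint:
  assumes "A \<in> carrier_mat n k" "x \<in> carrier_vec k" "y \<in> carrier_vec n"
  shows "(A *\<^sub>v x) \<bullet>c y = x \<bullet>c (mat_adjoint A *\<^sub>v y :: complex vec)"
proof -
  have "(A *\<^sub>v x) \<bullet>c y = (\<Sum>i<n. \<Sum>j<k. A $$ (i, j) * x $ j * cnj (y $ i))"
    using assms by (auto simp: scalar_prod_def sum_distrib_right atLeast0LessThan)
  also have "\<dots> = (\<Sum>j<k. \<Sum>i<n. A $$ (i, j) * x $ j * cnj (y $ i))"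
    by (rule sum.swap)
  also have "\<dots> = x \<bullet>c (mat_adjoint A *\<^sub>v y)"
    using assms by (auto simp: scalar_prod_def sum_distrib_left atLeast0LessThan mult_ac intro!: sum.cong)
  finally show ?thesis .
qed

text \<open>Gram-Schmidt on a basis that starts with \<open>v\<close> leaves \<open>v\<close> in
  first place, so normalising the result gives a unitary whose first column is a multiple of
  \<open>v\<close>. With an eigenvector as \<open>v\<close>, this drives the induction in the
  spectral theorem.\<close>

lemma ex_unitary_first_col:
  fixes v :: "complex vec"
  assumes v: "v \<in> carrier_vec n" and v0: "v \<noteq> 0\<^sub>v n" and n: "n \<noteq> 0"
  shows "\<exists>W c. W \<in> carrier_mat n n \<and> mat_adjoint W * W = 1\<^sub>m n \<and> col W 0 = c \<cdot>\<^sub>v v"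
proof -
  interpret cof_vec_space n "TYPE(complex)" .
  define b where "b = basis_completion v"
  define ws where "ws = gram_schmidt n b"
  note bc = basis_completion[OF v v0, folded b_def]
  obtain vs where bv: "b = v # vs"
    by (auto simp: b_def basis_completion_def Let_def)
  note gs = gram_schmidt_result[OF bc(2,4) _ refl, folded ws_def]
  have ws: "set ws \<subseteq> carrier_vec n" "corthogonal ws" "length ws = n"
    using bc gs by auto
  have hd: "hd ws = v"
    using gram_schmidt_hd[OF v, of vs, folded bv] by (simp add: ws_def)
  have ws0: "ws ! 0 = v"
    using hd ws(3) n hd_conv_nth[of ws] by auto
  \<comment> \<open>Gram-Schmidt yields orthogonal but unnormalised vectors, hence the division by
    their norms in \<open>W\<close>.\<close>
  define nr where "nr w = sqrt (Re (w \<bullet>c w))" for w :: "complex vec"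
  define W where "W = mat n n (\<lambda>(i, j). complex_of_real (1 / nr (ws ! j)) * ws ! j $ i)"
  have wsc: "ws ! j \<in> carrier_vec n" if "j < n" for j
    using ws that by auto
  have orth: "ws ! j \<bullet>c ws ! i = (if i = j then complex_of_real (nr (ws ! j) ^ 2) else 0)"
    and nz: "nr (ws ! j) \<noteq> 0" if "i < n" "j < n" for i j
  proof -
    have ge: "0 \<le> ws ! j \<bullet>c ws ! j"
      by (rule conjugate_square_ge_0_vec)
    \<comment> \<open>Besides orthogonality, \<open>corthogonal\<close> asserts that no vector of
      the list has zero norm, which makes the normalisation legitimate.\<close>
    have ne: "ws ! j \<bullet>c ws ! j \<noteq> 0"
      using corthogonalD[OF ws(2), of j j] that ws by auto
    have re: "complex_of_real (Re (ws ! j \<bullet>c ws ! j)) = ws ! j \<bullet>c ws ! j"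
      using ge by (simp add: complex_eq_iff less_eq_complex_def)
    have "Re (ws ! j \<bullet>c ws ! j) \<ge> 0"
      using ge by (simp add: less_eq_complex_def)
    then have "complex_of_real (nr (ws ! j) ^ 2) = ws ! j \<bullet>c ws ! j"
      using re by (simp add: nr_def)
    then show "nr (ws ! j) \<noteq> 0" "ws ! j \<bullet>c ws ! i = (if i = j then complex_of_real (nr (ws ! j) ^ 2) else 0)"
      using ne corthogonalD[OF ws(2), of j i] that ws by auto
  qed
  have "mat_adjoint W * W = 1\<^sub>m n"
  proof (rule eq_matI)
    fix i j assume "i < dim_row (1\<^sub>m n :: complex mat)" "j < dim_col (1\<^sub>m n :: complex mat)"
    then have ij: "i < n" "j < n" by auto
    have "(mat_adjoint W * W) $$ (i, j) =
        (\<Sum>k<n. complex_of_real (1 / nr (ws ! i)) * complex_of_real (1 / nr (ws ! j))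
            * (ws ! j $ k * cnj (ws ! i $ k)))"
      using ij by (auto simp: W_def scalar_prod_def atLeast0LessThan intro!: sum.cong)
    also have "\<dots> = complex_of_real (1 / nr (ws ! i)) * complex_of_real (1 / nr (ws ! j))
        * (ws ! j \<bullet>c ws ! i)"
      using wsc[OF ij(1)] wsc[OF ij(2)]
      by (auto simp: scalar_prod_def sum_distrib_left atLeast0LessThan intro!: sum.cong)
    also have "\<dots> = 1\<^sub>m n $$ (i, j)"
      unfolding orth[OF ij] using nz[OF ij] ij by (auto simp: power2_eq_square)
    finally show "(mat_adjoint W * W) $$ (i, j) = 1\<^sub>m n $$ (i, j)" .
  qed (auto simp: W_def)
  moreover have "col W 0 = complex_of_real (1 / nr v) \<cdot>\<^sub>v v"
    using ws0 n v by (intro eq_vecI) (auto simp: W_def)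
  ultimately show ?thesis
    by (intro exI[of _ W]) (auto simp: W_def)
qed

lemma unitary_right_inverse:
  fixes U :: "complex mat"
  assumes "U \<in> carrier_mat n n" "mat_adjoint U * U = 1\<^sub>m n"
  shows "U * mat_adjoint U = 1\<^sub>m n"
  using assms mat_mult_left_right_inverse[of "mat_adjoint U" n U] by simp

text \<open>Induction on the dimension: in an orthonormal basis beginning with an eigenvector, the
  first column is a multiple of the first unit vector, and Hermitian symmetry forces the same on the
  first row. The remaining block is Hermitian of one dimension less.\<close>

theorem hermitian_spectral_decomposition:
  assumes "A \<in> carrier_mat n n" "mat_adjoint A = A"
  shows "\<exists>U e. U \<in> carrier_mat n n \<and> mat_adjoint U * U = 1\<^sub>m n \<and>
           A = U * mat_diag n (\<lambda>i. complex_of_real (e i)) * mat_adjoint U"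
  using assms
proof (induction n arbitrary: A)
  case 0
  then show ?case
    by (intro exI[of _ "1\<^sub>m 0"] exI[of _ "\<lambda>_. 0"] conjI eq_matI) auto
next
  case (Suc n)
  let ?m = "Suc n"
  note A = Suc.prems(1)
  note [simp] = assoc_mult_mat[of _ ?m ?m _ ?m _ ?m] mult_carrier_mat[of _ ?m ?m _ ?m]
  obtain k v where ev: "eigenvector A v k"
    using spectrum_non_empty[OF A] by (auto simp: spectrum_def eigenvalue_def)
  then have v: "v \<in> carrier_vec ?m" "v \<noteq> 0\<^sub>v ?m" and Av: "A *\<^sub>v v = k \<cdot>\<^sub>v v"
    using A by (auto simp: eigenvector_def)
  obtain W c where W: "W \<in> carrier_mat ?m ?m" and WW: "mat_adjoint W * W = 1\<^sub>m ?m"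
      and W0: "col W 0 = c \<cdot>\<^sub>v v"
    using ex_unitary_first_col[OF v] by auto
  have WW': "W * mat_adjoint W = 1\<^sub>m ?m"
    using unitary_right_inverse[OF W WW] .
  define B where "B = mat_adjoint W * (A * W)"
  have Bc: "B \<in> carrier_mat ?m ?m"
    using W A by (auto simp: B_def)
  have Bh: "mat_adjoint B = B"
    using W A Suc.prems(2) by (simp add: B_def mat_adjoint_mult[of _ ?m ?m _ ?m])
  have "col (A * W) 0 = A *\<^sub>v col W 0"
    using A W by (intro eq_vecI) auto
  also have "\<dots> = k \<cdot>\<^sub>v col W 0"
    using A v Av by (simp add: W0 mult_mat_vec smult_smult_assoc mult.commute)
  finally have AW0: "col (A * W) 0 = k \<cdot>\<^sub>v col W 0" .
  \<comment> \<open>The first column of \<open>A * W\<close> is \<open>k\<close> times the first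
    column of \<open>W\<close>, and the columns of \<open>W\<close> are orthonormal.\<close>
  have B0: "B $$ (i, 0) = (if i = 0 then k else 0)" if i: "i < ?m" for i
  proof -
    have "B $$ (i, 0) = row (mat_adjoint W) i \<bullet> col (A * W) 0"
      using A W i by (simp add: B_def)
    also have "\<dots> = k * (mat_adjoint W * W) $$ (i, 0)"
      using W i by (simp add: AW0)
    finally show ?thesis
      using i by (simp add: WW)
  qed
  \<comment> \<open>As a diagonal entry of a Hermitian matrix, \<open>k\<close> equals its own
    conjugate; this is why the eigenvalues can be taken real.\<close>
  have k: "k = complex_of_real (Re k)"
    using hermitian_index[OF Bh Bc, of 0 0] B0[of 0] by (simp add: complex_eq_iff)
  define B' where "B' = mat n n (\<lambda>(i, j). B $$ (Suc i, Suc j))"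
  have B'c: "B' \<in> carrier_mat n n"
    by (simp add: B'_def)
  have "mat_adjoint B' = B'"
    by (rule hermitianI[OF B'c]) (use hermitian_index[OF Bh Bc] in \<open>auto simp: B'_def\<close>)
  from Suc.IH[OF B'c this] obtain V e where V: "V \<in> carrier_mat n n"
      and VV: "mat_adjoint V * V = 1\<^sub>m n"
      and B'eq: "B' = V * mat_diag n (\<lambda>i. complex_of_real (e i)) * mat_adjoint V"
    by auto
  define e' where "e' = case_nat (Re k) e"
  let ?D = "mat_diag n (\<lambda>i. complex_of_real (e i))"
  let ?D' = "mat_diag ?m (\<lambda>i. complex_of_real (e' i))"
  let ?k = "mat 1 1 (\<lambda>_. k)"
  \<comment> \<open>\<open>V'\<close> fixes the first basis vector and diagonalises the lower block,
    so the required unitary is \<open>W * V'\<close>.\<close>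
  define V' where "V' = four_block_mat (1\<^sub>m 1) (0\<^sub>m 1 n) (0\<^sub>m n 1) V"
  have V'c: "V' \<in> carrier_mat ?m ?m"
    using four_block_carrier_mat[of "1\<^sub>m 1" 1 1 V n n] V by (simp add: V'_def)
  have adjV': "mat_adjoint V' = four_block_mat (1\<^sub>m 1) (0\<^sub>m 1 n) (0\<^sub>m n 1) (mat_adjoint V)"
    using V by (intro eq_matI) (auto simp: V'_def)
  have Deq: "?D' = four_block_mat ?k (0\<^sub>m 1 n) (0\<^sub>m n 1) ?D"
    using k by (intro eq_matI) (auto simp: mat_diag_def e'_def split: nat.split)
  have Beq: "B = four_block_mat ?k (0\<^sub>m 1 n) (0\<^sub>m n 1) B'"
  proof (rule eq_matI)
    fix i j assume "i < dim_row (four_block_mat ?k (0\<^sub>m 1 n) (0\<^sub>m n 1) B')"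
      "j < dim_col (four_block_mat ?k (0\<^sub>m 1 n) (0\<^sub>m n 1) B')"
    then have ij: "i < ?m" "j < ?m"
      by (auto simp: B'_def)
    have "B $$ (0, j) = cnj (B $$ (j, 0))"
      using hermitian_index[OF Bh Bc, of j 0] ij by simp
    then have B0': "B $$ (0, j) = (if j = 0 then k else 0)"
      using B0[OF ij(2)] k by (metis complex_cnj_complex_of_real complex_cnj_zero)
    show "B $$ (i, j) = four_block_mat ?k (0\<^sub>m 1 n) (0\<^sub>m n 1) B' $$ (i, j)"
      using ij B0[OF ij(1)] B0' by (cases i; cases j) (auto simp: B'_def)
  qed (use Bc in \<open>auto simp: B'_def\<close>)
  have V'V': "mat_adjoint V' * V' = 1\<^sub>m ?m"
    unfolding adjV' unfolding V'_def
    using V VV by (subst mult_four_block_mat) auto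
  have "V' * ?D' = four_block_mat ?k (0\<^sub>m 1 n) (0\<^sub>m n 1) (V * ?D)"
    unfolding V'_def Deq using V by (subst mult_four_block_mat[of _ 1 1 _ n _ n _ _ 1 _ n])
      (auto simp: left_mult_zero_mat[of _ n n] right_mult_zero_mat[of _ n n])
  moreover have "four_block_mat ?k (0\<^sub>m 1 n) (0\<^sub>m n 1) (V * ?D) * mat_adjoint V' = B"
    unfolding adjV' Beq B'eq
    using V by (subst mult_four_block_mat[of _ 1 1 _ n _ n _ _ 1 _ n])
      (auto simp: left_mult_zero_mat[of _ n n] right_mult_zero_mat[of _ n n])
  ultimately have VB: "V' * (?D' * mat_adjoint V') = B"
    using V'c by (metis assoc_mult_mat mat_adjoint_carrier mat_diag_dim)
  have D'c [simp]: "?D' \<in> carrier_mat ?m ?m"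
    by simp
  note c = W V'c A mat_adjoint_carrier[OF W] mat_adjoint_carrier[OF V'c]
  have adjWV: "mat_adjoint (W * V') = mat_adjoint V' * mat_adjoint W"
    using W V'c by (rule mat_adjoint_mult)
  have "mat_adjoint (W * V') * (W * V') = mat_adjoint V' * (mat_adjoint W * W) * V'"
    unfolding adjWV using c by simp
  also have "\<dots> = 1\<^sub>m ?m"
    using c V'V' by (simp add: WW)
  finally have 1: "mat_adjoint (W * V') * (W * V') = 1\<^sub>m ?m" .
  have "W * V' * ?D' * mat_adjoint (W * V') = W * (V' * (?D' * mat_adjoint V')) * mat_adjoint W"
    unfolding adjWV using c by simp
  also have "\<dots> = (W * mat_adjoint W) * A * (W * mat_adjoint W)"
    unfolding VB B_def using c by simp
  also have "\<dots> = A"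
    using c by (simp add: WW')
  finally show ?case
    using 1 c by (intro exI[of _ "W * V'"] exI[of _ e']) auto
qed

section \<open>The trace norm\<close>

text \<open>The quadratic form at \<open>v\<close> is the squared norm of
  \<open>mat_adjoint C *\<^sub>v v\<close>. Positivity is always obtained from such a Gram form
  below.\<close>

lemma psd_gram:
  assumes C: "C \<in> carrier_mat n k"
  shows "psd_mat n (C * mat_adjoint C)"
  unfolding psd_mat_def
proof (intro conjI ballI)
  show "mat_adjoint (C * mat_adjoint C) = C * mat_adjoint C"
    using C by (simp add: mat_adjoint_mult[of _ n k _ n])
  fix v :: "complex vec" assume v: "v \<in> carrier_vec n"
  have "(C * mat_adjoint C *\<^sub>v v) \<bullet>c v = (C *\<^sub>v (mat_adjoint C *\<^sub>v v)) \<bullet>c v"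
    using C v by (simp add: assoc_mult_mat_vec[of _ n k _ n])
  also have "\<dots> = (mat_adjoint C *\<^sub>v v) \<bullet>c (mat_adjoint C *\<^sub>v v)"
    by (rule cscalar_mult_adjoint[OF C])
      (use C v mult_mat_vec_carrier[of "mat_adjoint C" k n v] in auto)
  finally show "0 \<le> (C * mat_adjoint C *\<^sub>v v) \<bullet>c v"
    by (simp add: conjugate_square_ge_0_vec)
qed (use C in auto)

text \<open>On the diagonal this is the quadratic form of \<open>A\<close> at a column of
  \<open>W\<close>, so positivity of \<open>A\<close> carries over to the diagonal entries of its
  conjugate.\<close>

lemma conjugation_index:
  fixes A W :: "complex mat"
  assumes "A \<in> carrier_mat n n" "W \<in> carrier_mat n n" "i < n" "j < n"
  shows "(mat_adjoint W * (A * W)) $$ (i, j) = (A *\<^sub>v col W j) \<bullet>c col W i"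
proof -
  have "row (mat_adjoint W) i = conjugate (col W i)"
    using assms by (intro eq_vecI) auto
  moreover have "col (A * W) j = A *\<^sub>v col W j"
    using assms by (intro eq_vecI) auto
  ultimately have "(mat_adjoint W * (A * W)) $$ (i, j) = conjugate (col W i) \<bullet> (A *\<^sub>v col W j)"
    using assms by simp
  also have "\<dots> = (A *\<^sub>v col W j) \<bullet>c col W i"
    using assms by (intro comm_scalar_prod[of _ n]) auto
  finally show ?thesis .
qed

text \<open>In an eigenbasis of \<open>B - C = diag e\<close>, with \<open>P\<close> and \<open>Q\<close> the matrices of \<open>B\<close> and \<open>C\<close>, the
  \<open>i\<close>-th diagonal entry of \<open>P\<^sup>2 - Q\<^sup>2 = 0\<close> is \<open>e\<^sub>i (P\<^sub>i\<^sub>i + Q\<^sub>i\<^sub>i)\<close>.\<close>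

lemma psd_sqrt_unique:
  assumes B: "psd_mat n B" and C: "psd_mat n C" and eq: "B * B = C * C"
  shows "B = C"
proof -
  note [simp] = assoc_mult_mat[of _ n n _ n _ n] mult_carrier_mat[of _ n n _ n]
  have Bc: "B \<in> carrier_mat n n" "mat_adjoint B = B" and Cc: "C \<in> carrier_mat n n" "mat_adjoint C = C"
    using B C by (auto simp: psd_mat_def)
  have h: "mat_adjoint (B - C) = B - C"
    by (rule hermitianI[of _ n])
      (use Bc Cc hermitian_index[OF Bc(2,1)] hermitian_index[OF Cc(2,1)] in auto)
  have BCc: "B - C \<in> carrier_mat n n"
    using Bc Cc by auto
  obtain U e where U: "U \<in> carrier_mat n n" and UU: "mat_adjoint U * U = 1\<^sub>m n"
      and X: "B - C = U * mat_diag n (\<lambda>i. complex_of_real (e i)) * mat_adjoint U"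
    using hermitian_spectral_decomposition[OF BCc h] by auto
  have UU': "U * mat_adjoint U = 1\<^sub>m n"
    using unitary_right_inverse[OF U UU] .
  let ?D = "mat_diag n (\<lambda>i. complex_of_real (e i))"
  define P where "P = mat_adjoint U * (B * U)"
  define Q where "Q = mat_adjoint U * (C * U)"
  have D [simp]: "?D \<in> carrier_mat n n"
    by simp
  note c = U mat_adjoint_carrier[OF U] Bc(1) Cc(1)
  have Pc: "P \<in> carrier_mat n n" and Qc: "Q \<in> carrier_mat n n"
    using c by (auto simp: P_def Q_def)
  \<comment> \<open>Conjugation by a unitary respects squares, because
    \<open>U * mat_adjoint U\<close> cancels in the middle.\<close>
  have conj_mult: "mat_adjoint U * (Y * U) * (mat_adjoint U * (Y * U)) = mat_adjoint U * ((Y * Y) * U)"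
    if Y: "Y \<in> carrier_mat n n" for Y
  proof -
    have "mat_adjoint U * (Y * U) * (mat_adjoint U * (Y * U))
        = mat_adjoint U * (Y * ((U * mat_adjoint U) * (Y * U)))"
      using c Y by simp
    then show ?thesis
      using c Y by (simp add: UU')
  qed
  have PQ: "P * P = Q * Q"
    unfolding P_def Q_def using conj_mult[OF Bc(1)] conj_mult[OF Cc(1)] eq by simp
  have "P - Q = mat_adjoint U * ((B - C) * U)"
    unfolding P_def Q_def using c
    by (simp add: mult_minus_distrib_mat[of _ n n _ n] minus_mult_distrib_mat[of _ n n _ _ n])
  also have "\<dots> = (mat_adjoint U * U) * (?D * (mat_adjoint U * U))"
    unfolding X using c by simp
  also have "\<dots> = ?D"
    by (simp add: UU)
  finally have PmQ: "P - Q = ?D" .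
  have Peq: "P $$ (i, j) = Q $$ (i, j) + (if i = j then complex_of_real (e i) else 0)"
    if "i < n" "j < n" for i j
  proof -
    have "P $$ (i, j) - Q $$ (i, j) = (P - Q) $$ (i, j)"
      using that Pc Qc by simp
    then show ?thesis
      unfolding PmQ using that by (auto simp: mat_diag_def algebra_simps)
  qed
  have e0: "e i = 0" if i: "i < n" for i
  proof -
    have "(\<Sum>k<n. P $$ (i, k) * P $$ (k, i)) = (P * P) $$ (i, i)"
      using Pc i by (simp add: scalar_prod_def atLeast0LessThan)
    also have "\<dots> = (\<Sum>k<n. Q $$ (i, k) * Q $$ (k, i))"
      unfolding PQ using Qc i by (simp add: scalar_prod_def atLeast0LessThan)
    finally have "0 = (\<Sum>k<n. P $$ (i, k) * P $$ (k, i) - Q $$ (i, k) * Q $$ (k, i))"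
      by (simp add: sum_subtractf)
    \<comment> \<open>Off the diagonal \<open>P\<close> and \<open>Q\<close> agree, so the products
      cancel except at \<open>k = i\<close>, where a difference of two squares remains and
      factors.\<close>
    also have "\<dots> = (\<Sum>k<n. if k = i then complex_of_real (e i) * (P $$ (i, i) + Q $$ (i, i)) else 0)"
      by (intro sum.cong refl) (use i in \<open>auto simp: Peq algebra_simps\<close>)
    also have "\<dots> = complex_of_real (e i) * (P $$ (i, i) + Q $$ (i, i))"
      using i by simp
    finally have *: "e i = 0 \<or> P $$ (i, i) + Q $$ (i, i) = 0"
      by simp
    have "0 \<le> P $$ (i, i)" "0 \<le> Q $$ (i, i)"
      unfolding P_def Q_def conjugation_index[OF Bc(1) U i i] conjugation_index[OF Cc(1) U i i]
      using B C c i by (auto simp: psd_mat_def)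
    \<comment> \<open>In the remaining case two nonnegative numbers sum to zero, so both vanish, and
      with them their difference \<open>e i\<close>.\<close>
    then have "P $$ (i, i) + Q $$ (i, i) = 0 \<Longrightarrow> P $$ (i, i) = 0 \<and> Q $$ (i, i) = 0"
      by (auto simp: less_eq_complex_def complex_eq_iff)
    with * Peq[OF i i] show ?thesis
      by auto
  qed
  have "?D = 0\<^sub>m n n"
    by (intro eq_matI) (auto simp: mat_diag_def e0)
  then have "B - C = 0\<^sub>m n n"
    unfolding X using c by simp
  then have "(B - C) $$ (i, j) = 0" if "i < n" "j < n" for i j
    using that by simp
  then show ?thesis
    using c by (intro eq_matI) auto
qed

text \<open>By uniqueness of positive square roots, the definite description in
  \<open>psd_sqrt\<close> is settled by exhibiting any positive semidefinite \<open>P\<close> with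
  the right square.\<close>

lemma tr_norm_eq_trace:
  assumes "P * P = mat_adjoint A * A" "psd_mat n P"
  shows "tr_norm A = Re (mat_trace P) / 2"
proof -
  have "P * P \<in> carrier_mat n n"
    using assms(2) by (auto simp: psd_mat_def)
  then have d: "dim_row (mat_adjoint A * A) = n"
    using assms(1) by auto
  have "psd_sqrt (mat_adjoint A * A) = P"
    unfolding psd_sqrt_def d
    by (rule the_equality) (use assms psd_sqrt_unique in auto)
  then show ?thesis
    by (simp add: tr_norm_def)
qed

section \<open>Functional calculus and the variational formula for the trace norm\<close>

lemma mat_trace_mult_commute:
  assumes "A \<in> carrier_mat n k" "B \<in> carrier_mat k n"
  shows "mat_trace (A * B) = mat_trace (B * A)"
proof -
  have "mat_trace (A * B) = (\<Sum>i<n. \<Sum>j<k. A $$ (i, j) * B $$ (j, i))"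
    using assms by (auto simp: mat_trace_def scalar_prod_def atLeast0LessThan)
  also have "\<dots> = (\<Sum>j<k. \<Sum>i<n. A $$ (i, j) * B $$ (j, i))"
    by (rule sum.swap)
  also have "\<dots> = mat_trace (B * A)"
    using assms by (auto simp: mat_trace_def scalar_prod_def atLeast0LessThan mult.commute)
  finally show ?thesis .
qed

text \<open>The matrices \<open>U * diag f * mat_adjoint U\<close> are the functional calculus of
  \<open>A\<close>: different \<open>f\<close> give \<open>A\<close>, its absolute value and its
  square in one eigenbasis.\<close>

locale spectral_decomposition =
  fixes n :: nat and A U :: "complex mat" and e :: "nat \<Rightarrow> real"
  assumes U: "U \<in> carrier_mat n n" and UU: "mat_adjoint U * U = 1\<^sub>m n"
    and A_eq: "A = U * mat_diag n (\<lambda>i. complex_of_real (e i)) * mat_adjoint U"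
begin

abbreviation diag :: "(nat \<Rightarrow> real) \<Rightarrow> complex mat" where
  "diag f \<equiv> mat_diag n (\<lambda>i. complex_of_real (f i))"

lemma adjU: "mat_adjoint U \<in> carrier_mat n n"
  using U by simp

lemma A_carrier: "A \<in> carrier_mat n n"
  unfolding A_eq using U by (intro mult_carrier_mat[of _ n n]) auto

lemmas mats = U adjU carrier_matD[OF U] assoc_mult_mat[of _ n n _ n _ n] mult_carrier_mat[of _ n n _ n]

lemma conj_diag_mult:
  "U * diag f * mat_adjoint U * (U * diag g * mat_adjoint U) = U * diag (\<lambda>i. f i * g i) * mat_adjoint U"
proof -
  have "U * diag f * mat_adjoint U * (U * diag g * mat_adjoint U)
      = U * (diag f * ((mat_adjoint U * U) * (diag g * mat_adjoint U)))"
    by (simp add: mats)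
  also have "\<dots> = U * ((diag f * diag g) * mat_adjoint U)"
    by (simp add: mats UU del: mat_diag_diag)
  finally show ?thesis
    by (simp add: mats)
qed

lemma trace_conj_diag: "mat_trace (U * diag f * mat_adjoint U) = complex_of_real (\<Sum>i<n. f i)"
proof -
  have "mat_trace (U * diag f * mat_adjoint U) = mat_trace (mat_adjoint U * (U * diag f))"
    by (rule mat_trace_mult_commute[of _ n n]) (simp_all add: mats)
  also have "mat_adjoint U * (U * diag f) = (mat_adjoint U * U) * diag f"
    by (simp add: mats)
  also have "\<dots> = diag f"
    by (simp add: UU)
  also have "mat_trace (diag f) = complex_of_real (\<Sum>i<n. f i)"
    by (simp add: mat_trace_def mat_diag_def)
  finally show ?thesis .
qed

lemma adjoint_conj_diag: "mat_adjoint (U * diag f * mat_adjoint U) = U * diag f * mat_adjoint U"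
  by (simp add: mats mat_adjoint_mult[of _ n n _ n])

lemma hermitian: "mat_adjoint A = A"
  unfolding A_eq by (rule adjoint_conj_diag)

text \<open>The factor is \<open>U\<close> times the diagonal of square roots. A Gram factor is
  recorded, rather than mere positivity, because such factors can be assembled block by
  block.\<close>

lemma psd_conj_diag:
  assumes "\<And>i. f i \<ge> 0"
  shows "\<exists>C \<in> carrier_mat n n. C * mat_adjoint C = U * diag f * mat_adjoint U"
proof
  let ?C = "U * diag (\<lambda>i. sqrt (f i))"
  show "?C \<in> carrier_mat n n"
    by (simp add: mats)
  have "mat_adjoint ?C = diag (\<lambda>i. sqrt (f i)) * mat_adjoint U"
    using U by (simp add: mat_adjoint_mult[of _ n n _ n])
  then have "?C * mat_adjoint ?C = U * ((diag (\<lambda>i. sqrt (f i)) * diag (\<lambda>i. sqrt (f i))) * mat_adjoint U)"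
    by (simp add: mats del: mat_diag_diag)
  also have "diag (\<lambda>i. sqrt (f i)) * diag (\<lambda>i. sqrt (f i)) = diag f"
    using assms by (simp flip: of_real_mult)
  finally show "?C * mat_adjoint ?C = U * diag f * mat_adjoint U"
    by (simp add: mats)
qed

text \<open>The Gram matrix is the absolute value of \<open>A\<close>; squaring removes the absolute
  values of the eigenvalues.\<close>

lemma abs_gram:
  "\<exists>C \<in> carrier_mat n n. C * mat_adjoint C * (C * mat_adjoint C) = A * A"
proof -
  obtain C where C: "C \<in> carrier_mat n n" "C * mat_adjoint C = U * diag (\<lambda>i. \<bar>e i\<bar>) * mat_adjoint U"
    using psd_conj_diag[of "\<lambda>i. \<bar>e i\<bar>"] by auto
  have "C * mat_adjoint C * (C * mat_adjoint C) = A * A"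
    unfolding C(2) unfolding A_eq conj_diag_mult by simp
  with C show ?thesis by blast
qed

lemma tr_norm_eq: "2 * tr_norm A = (\<Sum>i<n. \<bar>e i\<bar>)"
proof -
  let ?P = "U * diag (\<lambda>i. \<bar>e i\<bar>) * mat_adjoint U"
  obtain C where "C \<in> carrier_mat n n" "C * mat_adjoint C = ?P"
    using psd_conj_diag[of "\<lambda>i. \<bar>e i\<bar>"] by auto
  then have "psd_mat n ?P"
    using psd_gram by metis
  moreover have "?P * ?P = mat_adjoint A * A"
    unfolding hermitian unfolding A_eq conj_diag_mult by simp
  ultimately have "tr_norm A = Re (mat_trace ?P) / 2"
    using tr_norm_eq_trace by blast
  then show ?thesis
    by (simp add: trace_conj_diag)
qed

text \<open>Both sides are the trace of \<open>A * A\<close>, once by Hermitian symmetry of the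
  entries and once in the eigenbasis.\<close>

lemma sum_norm_sq: "(\<Sum>i<n. \<Sum>j<n. (cmod (A $$ (i, j)))\<^sup>2) = (\<Sum>i<n. (e i)\<^sup>2)"
proof -
  have "complex_of_real (\<Sum>i<n. \<Sum>j<n. (cmod (A $$ (i, j)))\<^sup>2) = mat_trace (A * A)"
    using A_carrier hermitian_index[OF hermitian A_carrier]
    by (simp add: mat_trace_def scalar_prod_def atLeast0LessThan complex_norm_square del: of_real_power)
  also have "\<dots> = complex_of_real (\<Sum>i<n. (e i)\<^sup>2)"
    unfolding A_eq conj_diag_mult trace_conj_diag by (simp add: power2_eq_square)
  finally show ?thesis
    using of_real_eq_iff by blast
qed

text \<open>In any orthonormal basis, the diagonal entries are combinations of the eigenvalues with
  weights the squared moduli of the entries of a unitary \<open>V\<close>. Equality holds in the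
  eigenbasis, so \<open>2 * tr_norm A\<close> is a maximum over orthonormal bases; the triangle
  inequality rests on this.\<close>

lemma sum_diag_conj_le:
  assumes W: "W \<in> carrier_mat n n" and WW: "mat_adjoint W * W = 1\<^sub>m n"
  shows "(\<Sum>i<n. cmod ((mat_adjoint W * (A * W)) $$ (i, i))) \<le> 2 * tr_norm A"
proof -
  define V where "V = mat_adjoint U * W"
  note c = mats W mat_adjoint_carrier[OF W]
  have V: "V \<in> carrier_mat n n"
    by (simp add: c V_def)
  have adjV: "mat_adjoint V = mat_adjoint W * U"
    by (simp add: c V_def mat_adjoint_mult[of _ n n _ n])
  have "V * mat_adjoint V = mat_adjoint U * ((W * mat_adjoint W) * U)"
    unfolding adjV unfolding V_def by (simp add: c)
  also have "\<dots> = 1\<^sub>m n"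
    using unitary_right_inverse[OF W WW] by (simp add: c UU)
  finally have VV: "V * mat_adjoint V = 1\<^sub>m n" .
  have eq: "mat_adjoint W * (A * W) = mat_adjoint V * (diag e * V)"
    unfolding adjV unfolding V_def A_eq by (simp add: c)
  \<comment> \<open>The weights with which an eigenvalue enters the diagonal sum to one, since the
    rows of \<open>V\<close> are unit vectors.\<close>
  have row: "(\<Sum>i<n. (cmod (V $$ (k, i)))\<^sup>2) = 1" if k: "k < n" for k
  proof -
    have "complex_of_real (\<Sum>i<n. (cmod (V $$ (k, i)))\<^sup>2) = (V * mat_adjoint V) $$ (k, k)"
      using k V by (simp add: scalar_prod_def atLeast0LessThan complex_norm_square del: of_real_power)
    also have "\<dots> = complex_of_real 1"
      using k VV by simp
    finally show ?thesis
      using of_real_eq_iff by blast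
  qed
  have "cmod ((mat_adjoint W * (A * W)) $$ (i, i)) \<le> (\<Sum>k<n. \<bar>e k\<bar> * (cmod (V $$ (k, i)))\<^sup>2)"
    if i: "i < n" for i
  proof -
    have "(mat_adjoint V * (diag e * V)) $$ (i, i)
        = (\<Sum>k<n. cnj (V $$ (k, i)) * (complex_of_real (e k) * V $$ (k, i)))"
      using V i by (simp add: mat_diag_mult_left[OF V] scalar_prod_def atLeast0LessThan)
    also have "cmod \<dots> \<le> (\<Sum>k<n. cmod (cnj (V $$ (k, i)) * (complex_of_real (e k) * V $$ (k, i))))"
      by (rule norm_sum)
    also have "\<dots> = (\<Sum>k<n. \<bar>e k\<bar> * (cmod (V $$ (k, i)))\<^sup>2)"
      by (simp add: norm_mult power2_eq_square mult_ac)
    finally show ?thesis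
      by (simp add: eq)
  qed
  then have "(\<Sum>i<n. cmod ((mat_adjoint W * (A * W)) $$ (i, i)))
      \<le> (\<Sum>i<n. \<Sum>k<n. \<bar>e k\<bar> * (cmod (V $$ (k, i)))\<^sup>2)"
    by (intro sum_mono) auto
  also have "\<dots> = (\<Sum>k<n. \<bar>e k\<bar> * (\<Sum>i<n. (cmod (V $$ (k, i)))\<^sup>2))"
    by (subst sum.swap) (simp add: sum_distrib_left)
  also have "\<dots> = 2 * tr_norm A"
    by (simp add: row tr_norm_eq)
  finally show ?thesis .
qed

lemma sum_diag_conj_eigenbasis:
  "(\<Sum>i<n. cmod ((mat_adjoint U * (A * U)) $$ (i, i))) = 2 * tr_norm A"
proof -
  have "mat_adjoint U * (A * U) = (mat_adjoint U * U) * (diag e * (mat_adjoint U * U))"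
    unfolding A_eq by (simp add: mats)
  also have "\<dots> = diag e"
    by (simp add: UU)
  finally show ?thesis
    by (simp add: tr_norm_eq mat_diag_def)
qed

end

section \<open>Triangle inequality and comparison with the Hilbert-Schmidt norm\<close>

lemma ex_spectral_decomposition:
  assumes "A \<in> carrier_mat n n" "mat_adjoint A = A"
  obtains U e where "spectral_decomposition n A U e"
  using hermitian_spectral_decomposition[OF assms] by (auto simp: spectral_decomposition_def)

lemma tr_norm_nonneg:
  assumes "A \<in> carrier_mat n n" "mat_adjoint A = A"
  shows "0 \<le> tr_norm A"
proof -
  obtain U e where "spectral_decomposition n A U e"
    using ex_spectral_decomposition[OF assms] .
  then interpret spectral_decomposition n A U e .
  have "0 \<le> 2 * tr_norm A"
    unfolding tr_norm_eq by (simp add: sum_nonneg)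
  then show ?thesis by simp
qed

text \<open>Diagonals are compared in an eigenbasis of \<open>A\<close>: there \<open>A\<close>
  attains twice its trace norm, while each \<open>D x\<close> stays below twice its own. Linearity
  is assumed entrywise so that Fourier sums of matrix entries fit directly.\<close>

lemma tr_norm_sum_le:
  fixes c :: "'a \<Rightarrow> real"
  assumes A: "A \<in> carrier_mat n n" "mat_adjoint A = A"
    and D: "\<And>x. x \<in> I \<Longrightarrow> D x \<in> carrier_mat n n" "\<And>x. x \<in> I \<Longrightarrow> mat_adjoint (D x) = D x"
    and eq: "\<And>i j. i < n \<Longrightarrow> j < n \<Longrightarrow> A $$ (i, j) = (\<Sum>x\<in>I. complex_of_real (c x) * D x $$ (i, j))"
  shows "tr_norm A \<le> (\<Sum>x\<in>I. \<bar>c x\<bar> * tr_norm (D x))"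
proof -
  obtain U e where sd: "spectral_decomposition n A U e"
    using ex_spectral_decomposition[OF A] .
  then interpret spectral_decomposition n A U e .
  have conj: "(mat_adjoint U * (B * U)) $$ (i, i)
      = (\<Sum>j<n. \<Sum>k<n. cnj (U $$ (j, i)) * B $$ (j, k) * U $$ (k, i))"
    if "B \<in> carrier_mat n n" "i < n" for B i
    using that U by (simp add: scalar_prod_def atLeast0LessThan sum_distrib_left mult_ac)
  have lin: "(mat_adjoint U * (A * U)) $$ (i, i)
      = (\<Sum>x\<in>I. complex_of_real (c x) * (mat_adjoint U * (D x * U)) $$ (i, i))" if i: "i < n" for i
  proof -
    have "(mat_adjoint U * (A * U)) $$ (i, i) = (\<Sum>j<n. \<Sum>k<n. \<Sum>x\<in>I.
        complex_of_real (c x) * (cnj (U $$ (j, i)) * D x $$ (j, k) * U $$ (k, i)))"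
      unfolding conj[OF A(1) i]
      by (intro sum.cong refl) (simp add: eq sum_distrib_left sum_distrib_right mult_ac)
    also have "\<dots> = (\<Sum>x\<in>I. \<Sum>j<n. \<Sum>k<n.
        complex_of_real (c x) * (cnj (U $$ (j, i)) * D x $$ (j, k) * U $$ (k, i)))"
      by (simp only: sum.swap[where A = "{..<n}" and B = I])
    also have "\<dots> = (\<Sum>x\<in>I. complex_of_real (c x) * (mat_adjoint U * (D x * U)) $$ (i, i))"
      by (intro sum.cong refl) (simp only: conj[OF D(1) i] sum_distrib_left)
    finally show ?thesis .
  qed
  have "2 * tr_norm A = (\<Sum>i<n. cmod ((mat_adjoint U * (A * U)) $$ (i, i)))"
    by (rule sum_diag_conj_eigenbasis[symmetric])
  also have "\<dots> \<le> (\<Sum>i<n. \<Sum>x\<in>I. \<bar>c x\<bar> * cmod ((mat_adjoint U * (D x * U)) $$ (i, i)))"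
    by (intro sum_mono, subst lin) (auto intro!: sum_norm_le simp: norm_mult)
  also have "\<dots> = (\<Sum>x\<in>I. \<bar>c x\<bar> * (\<Sum>i<n. cmod ((mat_adjoint U * (D x * U)) $$ (i, i))))"
    by (subst sum.swap) (simp add: sum_distrib_left)
  also have "\<dots> \<le> (\<Sum>x\<in>I. \<bar>c x\<bar> * (2 * tr_norm (D x)))"
  proof (intro sum_mono mult_left_mono)
    fix x assume x: "x \<in> I"
    obtain U' e' where "spectral_decomposition n (D x) U' e'"
      using ex_spectral_decomposition[OF D[OF x]] .
    then show "(\<Sum>i<n. cmod ((mat_adjoint U * (D x * U)) $$ (i, i))) \<le> 2 * tr_norm (D x)"
      by (rule spectral_decomposition.sum_diag_conj_le) (rule U UU)+
  qed auto
  also have "\<dots> = 2 * (\<Sum>x\<in>I. \<bar>c x\<bar> * tr_norm (D x))"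
    by (simp add: sum_distrib_left mult_ac)
  finally show ?thesis by simp
qed

text \<open>The square of the Hilbert-Schmidt norm; as a sum over entries it admits Parseval entry
  by entry.\<close>

definition hs_norm_sq :: "nat \<Rightarrow> complex mat \<Rightarrow> real" where
  "hs_norm_sq n A = (\<Sum>i<n. \<Sum>j<n. (cmod (A $$ (i, j)))\<^sup>2)"

text \<open>On the eigenvalues this compares the \<open>l1\<close> and \<open>l2\<close> norms:
  Cauchy-Schwarz over \<open>n\<close> terms one way, nonnegative cross terms the other way.\<close>

lemma tr_norm_hs_norm:
  assumes "A \<in> carrier_mat n n" "mat_adjoint A = A"
  shows "(2 * tr_norm A)\<^sup>2 \<le> real n * hs_norm_sq n A" "hs_norm_sq n A \<le> (2 * tr_norm A)\<^sup>2"
proof -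
  obtain U e where "spectral_decomposition n A U e"
    using ex_spectral_decomposition[OF assms] .
  then interpret spectral_decomposition n A U e .
  have hs: "hs_norm_sq n A = (\<Sum>i<n. \<bar>e i\<bar>\<^sup>2)"
    by (simp add: hs_norm_sq_def sum_norm_sq)
  show "(2 * tr_norm A)\<^sup>2 \<le> real n * hs_norm_sq n A"
    unfolding tr_norm_eq hs using sum_squared_le_sum_of_squares[of "\<lambda>i. \<bar>e i\<bar>" "{..<n}"]
    by (simp add: mult.commute)
  have "(\<Sum>i<k. \<bar>e i\<bar>\<^sup>2) \<le> (\<Sum>i<k. \<bar>e i\<bar>)\<^sup>2" for k
    by (induction k) (auto simp: power2_sum intro!: add_increasing2 sum_nonneg)
  then show "hs_norm_sq n A \<le> (2 * tr_norm A)\<^sup>2"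
    unfolding tr_norm_eq hs .
qed

section \<open>Block-diagonal matrices\<close>

text \<open>The direct sum of \<open>F 0\<close> to \<open>F (K - 1)\<close>. Splitting an index
  into \<open>i div n\<close> and \<open>i mod n\<close> matches the convention of
  \<open>kron\<close> with the classical register on the left.\<close>

definition block_diag :: "nat \<Rightarrow> nat \<Rightarrow> (nat \<Rightarrow> complex mat) \<Rightarrow> complex mat" where
  "block_diag K n F = mat (K * n) (K * n)
     (\<lambda>(i, j). if i div n = j div n then F (i div n) $$ (i mod n, j mod n) else 0)"

lemma block_diag_carrier [simp]: "block_diag K n F \<in> carrier_mat (K * n) (K * n)"
  and block_diag_dims [simp]: "dim_row (block_diag K n F) = K * n" "dim_col (block_diag K n F) = K * n"
  by (simp_all add: block_diag_def)

lemma div_mod_bounds: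
  assumes "i < K * n"
  shows "i div n < K" "i mod n < (n :: nat)"
  using assms by (cases "n = 0"; simp add: less_mult_imp_div_less)+

lemma block_diag_cong:
  assumes "\<And>k. k < K \<Longrightarrow> F k = G k"
  shows "block_diag K n F = block_diag K n G"
  by (rule eq_matI) (auto simp: block_diag_def assms div_mod_bounds)

lemma sum_block: "(\<Sum>i<K * n. f i) = (\<Sum>k<K. \<Sum>r<n. f (k * n + r))" for f :: "nat \<Rightarrow> 'a :: comm_monoid_add"
proof -
  have "sum f {k * n..<k * n + n} = (\<Sum>r<n. f (k * n + r))" for k
    using sum.shift_bounds_nat_ivl[of f 0 "k * n" n] by (simp add: atLeast0LessThan add.commute)
  then show ?thesis
    by (simp flip: sum.nat_group)
qed

lemma block_diag_mult:
  assumes F: "\<And>k. k < K \<Longrightarrow> F k \<in> carrier_mat n n" and G: "\<And>k. k < K \<Longrightarrow> G k \<in> carrier_mat n n"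
  shows "block_diag K n F * block_diag K n G = block_diag K n (\<lambda>k. F k * G k)"
proof (rule eq_matI)
  fix i j assume "i < dim_row (block_diag K n (\<lambda>k. F k * G k))" "j < dim_col (block_diag K n (\<lambda>k. F k * G k))"
  then have ij: "i < K * n" "j < K * n" by auto
  note b = div_mod_bounds[OF ij(1)] div_mod_bounds[OF ij(2)]
  have "(block_diag K n F * block_diag K n G) $$ (i, j)
      = (\<Sum>l<K * n. block_diag K n F $$ (i, l) * block_diag K n G $$ (l, j))"
    using ij by (simp add: scalar_prod_def atLeast0LessThan)
  also have "\<dots> = (\<Sum>l<K * n. (if i div n = l div n then F (i div n) $$ (i mod n, l mod n) else 0)
      * (if l div n = j div n then G (l div n) $$ (l mod n, j mod n) else 0))"
    using ij by (simp add: block_diag_def)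
  \<comment> \<open>The middle index is split into block \<open>k\<close> and offset
    \<open>r\<close>; only the block \<open>i div n\<close> survives, and only if it is also the
    block of \<open>j\<close>.\<close>
  also have "\<dots> = (\<Sum>k<K. if k = i div n then if i div n = j div n then
      (\<Sum>r<n. F k $$ (i mod n, r) * G k $$ (r, j mod n)) else 0 else 0)"
    unfolding sum_block by (intro sum.cong refl) auto
  also have "\<dots> = block_diag K n (\<lambda>k. F k * G k) $$ (i, j)"
    using b ij F[OF b(1)] G[OF b(1)] F[OF b(3)] G[OF b(3)]
    by (auto simp: block_diag_def scalar_prod_def atLeast0LessThan)
  finally show "(block_diag K n F * block_diag K n G) $$ (i, j) = block_diag K n (\<lambda>k. F k * G k) $$ (i, j)" .
qed auto

lemma block_diag_adjoint:
  assumes F: "\<And>k. k < K \<Longrightarrow> F k \<in> carrier_mat n n"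
  shows "mat_adjoint (block_diag K n F) = block_diag K n (\<lambda>k. mat_adjoint (F k))"
proof (rule eq_matI)
  fix i j assume "i < dim_row (block_diag K n (\<lambda>k. mat_adjoint (F k)))"
    "j < dim_col (block_diag K n (\<lambda>k. mat_adjoint (F k)))"
  then have ij: "i < K * n" "j < K * n" by auto
  note b = div_mod_bounds[OF ij(1)] div_mod_bounds[OF ij(2)]
  show "mat_adjoint (block_diag K n F) $$ (i, j) = block_diag K n (\<lambda>k. mat_adjoint (F k)) $$ (i, j)"
    using b ij F[OF b(1)] F[OF b(3)] by (simp add: block_diag_def)
qed auto

lemma mat_trace_block_diag:
  assumes F: "\<And>k. k < K \<Longrightarrow> F k \<in> carrier_mat n n"
  shows "mat_trace (block_diag K n F) = (\<Sum>k<K. mat_trace (F k))"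
proof -
  have "mat_trace (block_diag K n F) = (\<Sum>i<K * n. F (i div n) $$ (i mod n, i mod n))"
    by (simp add: mat_trace_def block_diag_def)
  also have "\<dots> = (\<Sum>k<K. mat_trace (F k))"
    unfolding sum_block by (intro sum.cong refl) (use F in \<open>auto simp: mat_trace_def\<close>)
  finally show ?thesis .
qed

text \<open>The direct sum of the absolute values of the blocks is the positive square root of the
  squared direct sum, so its trace adds up. Its positivity is immediate because the direct sum of
  the Gram factors \<open>C k\<close> is a Gram factor for it.\<close>

lemma tr_norm_block_diag:
  assumes F: "\<And>k. k < K \<Longrightarrow> F k \<in> carrier_mat n n" and h: "\<And>k. k < K \<Longrightarrow> mat_adjoint (F k) = F k"
  shows "tr_norm (block_diag K n F) = (\<Sum>k<K. tr_norm (F k))"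
proof -
  have "\<exists>C. C \<in> carrier_mat n n \<and> C * mat_adjoint C * (C * mat_adjoint C) = F k * F k" if k: "k < K" for k
  proof -
    obtain U e where "spectral_decomposition n (F k) U e"
      using ex_spectral_decomposition[OF F[OF k] h[OF k]] .
    from spectral_decomposition.abs_gram[OF this] show ?thesis by blast
  qed
  then obtain C where C: "\<And>k. k < K \<Longrightarrow> C k \<in> carrier_mat n n"
      and CC: "\<And>k. k < K \<Longrightarrow> C k * mat_adjoint (C k) * (C k * mat_adjoint (C k)) = F k * F k"
    by metis
  let ?P = "\<lambda>k. C k * mat_adjoint (C k)"
  have P: "?P k \<in> carrier_mat n n" if "k < K" for k
    using C[OF that] by auto
  have eq: "block_diag K n C * mat_adjoint (block_diag K n C) = block_diag K n ?P"
    using C by (simp add: block_diag_adjoint block_diag_mult)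
  have "psd_mat (K * n) (block_diag K n ?P)"
    using psd_gram[OF block_diag_carrier, of K n C] unfolding eq .
  moreover have "block_diag K n ?P * block_diag K n ?P
      = mat_adjoint (block_diag K n F) * block_diag K n F"
    using P F CC h by (simp add: block_diag_adjoint block_diag_mult cong: block_diag_cong)
  ultimately have "tr_norm (block_diag K n F) = Re (mat_trace (block_diag K n ?P)) / 2"
    by (rule tr_norm_eq_trace[rotated])
  also have "\<dots> = (\<Sum>k<K. Re (mat_trace (?P k)) / 2)"
    using P by (simp add: mat_trace_block_diag sum_divide_distrib)
  also have "\<dots> = (\<Sum>k<K. tr_norm (F k))"
    using psd_gram[OF C] CC h by (intro sum.cong refl tr_norm_eq_trace[symmetric]) auto
  finally show ?thesis .
qed

section \<open>Fourier transform on bit strings\<close>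

lemma bitstrings_0 [simp]: "bitstrings 0 = {[]}"
  by (auto simp: bitstrings_def)

lemma bitstrings_Suc: "bitstrings (Suc m) = (#) True ` bitstrings m \<union> (#) False ` bitstrings m"
  by (auto simp: bitstrings_def length_Suc_conv image_iff)

lemma finite_bitstrings [simp]: "finite (bitstrings m)"
  by (induction m) (auto simp: bitstrings_Suc)

lemma sum_bitstrings_Suc:
  "(\<Sum>z\<in>bitstrings (Suc m). f z) = (\<Sum>z\<in>bitstrings m. f (True # z)) + (\<Sum>z\<in>bitstrings m. f (False # z))"
  unfolding bitstrings_Suc by (subst sum.union_disjoint) (auto simp: sum.reindex)

lemma card_bitstrings [simp]: "card (bitstrings m) = 2 ^ m"
  using sum_bitstrings_Suc[of "\<lambda>_. 1 :: nat"] by (induction m) auto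

section \<open>Numbering of the basis vectors by bit strings\<close>

definition bits_value :: "bool list \<Rightarrow> nat" where
  "bits_value z = horner_sum of_bool 2 (rev z)"

text \<open>Equal numbers have equal bits, which gives injectivity; the image lies in a set of the
  same finite cardinality, so it is all of it.\<close>

lemma bits_value_bij: "bij_betw bits_value (bitstrings m) {..<2 ^ m}"
proof -
  have inj: "inj_on bits_value (bitstrings m)"
  proof (rule inj_onI)
    fix z w assume zw: "z \<in> bitstrings m" "w \<in> bitstrings m" and eq: "bits_value z = bits_value w"
    have "rev z ! i = rev w ! i" if "i < m" for i
      using that zw arg_cong[OF eq, of "\<lambda>x. bit x i"]
      by (simp add: bits_value_def bit_horner_sum_bit_iff bitstrings_def)
    then have "rev z = rev w"
      using zw by (intro nth_equalityI) (auto simp: bitstrings_def)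
    then show "z = w" by simp
  qed
  have "(horner_sum of_bool 2 xs :: nat) < 2 ^ length xs" for xs
    by (induction xs) auto
  from this[of "rev _"] have "bits_value ` bitstrings m \<subseteq> {..<2 ^ m}"
    by (auto simp: bits_value_def bitstrings_def)
  then have "bits_value ` bitstrings m = {..<2 ^ m}"
    by (rule card_subset_eq[rotated]) (simp_all add: card_image[OF inj])
  with inj show ?thesis
    by (simp add: bij_betw_def)
qed

section \<open>Characters, Parseval and inversion\<close>

definition character :: "bool list \<Rightarrow> bool list \<Rightarrow> real" where
  "character S z = (if bit_dot S z then - 1 else 1)"

lemma character_Cons:
  "character (a # S) (b # z) = (if a \<and> b then - 1 else 1) * character S z"
  by (auto simp: character_def bit_dot_def sum.lessThan_Suc_shift simp del: sum.lessThan_Suc)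

lemma abs_character [simp]: "\<bar>character S z\<bar> = 1"
  by (simp add: character_def)

lemma character_commute: "length S = length z \<Longrightarrow> character S z = character z S"
  by (simp add: character_def bit_dot_def mult.commute)

lemma character_zero [simp]: "character (replicate m False) z = 1"
  by (simp add: character_def bit_dot_def)

text \<open>Induction on the length: the strings \<open>S\<close> starting with \<open>True\<close>
  repeat the sum over those starting with \<open>False\<close>, with sign -1 exactly if the first
  bits of \<open>z\<close> and \<open>w\<close> differ. The two halves cancel or double
  accordingly.\<close>

lemma character_orthogonal:
  assumes "z \<in> bitstrings m" "w \<in> bitstrings m"
  shows "(\<Sum>S\<in>bitstrings m. character S z * character S w) = (if z = w then 2 ^ m else 0)"
  using assms
proof (induction m arbitrary: z w)
  case 0
  then show ?case by (simp add: character_def)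
next
  case (Suc m)
  obtain a z' b w' where zw: "z = a # z'" "w = b # w'" "z' \<in> bitstrings m" "w' \<in> bitstrings m"
    using Suc.prems by (auto simp: bitstrings_Suc)
  let ?s = "\<Sum>S\<in>bitstrings m. character S z' * character S w'"
  have "(\<Sum>S\<in>bitstrings (Suc m). character S z * character S w)
      = (if a = b then 1 else - 1) * ?s + ?s"
    unfolding sum_bitstrings_Suc
    by (auto simp: zw character_Cons sum_negf)
  then show ?case
    using Suc.IH[OF zw(3,4)] zw by auto
qed

text \<open>This is orthogonality of \<open>S\<close> and the zero string, after exchanging the
  arguments of the characters.\<close>

lemma character_sum_zero:
  assumes "S \<in> bitstrings m" "S \<noteq> replicate m False"
  shows "(\<Sum>z\<in>bitstrings m. character S z) = 0"
proof -
  have 0: "replicate m False \<in> bitstrings m"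
    by (simp add: bitstrings_def)
  have "(\<Sum>z\<in>bitstrings m. character S z)
      = (\<Sum>z\<in>bitstrings m. character z S * character z (replicate m False))"
    using assms 0 by (intro sum.cong refl) (auto simp: bitstrings_def character_commute[of S] character_commute[of _ "replicate m False"])
  also have "\<dots> = 0"
    using character_orthogonal[OF assms(1) 0] assms(2) by simp
  finally show ?thesis .
qed

text \<open>Expanding the squares and summing over \<open>S\<close> first leaves only
  \<open>z = w\<close>, by orthogonality. The transform is unnormalised, hence the factor
  \<open>2 ^ m\<close>.\<close>

lemma fourier_parseval:
  fixes a :: "bool list \<Rightarrow> complex"
  shows "(\<Sum>S\<in>bitstrings m. (cmod (\<Sum>z\<in>bitstrings m. complex_of_real (character S z) * a z))\<^sup>2)
       = 2 ^ m * (\<Sum>z\<in>bitstrings m. (cmod (a z))\<^sup>2)"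
proof -
  let ?B = "bitstrings m"
  have "complex_of_real (\<Sum>S\<in>?B. (cmod (\<Sum>z\<in>?B. complex_of_real (character S z) * a z))\<^sup>2)
      = (\<Sum>S\<in>?B. \<Sum>z\<in>?B. \<Sum>w\<in>?B. complex_of_real (character S z * character S w) * (a z * cnj (a w)))"
    by (simp add: complex_norm_square sum_product mult_ac del: of_real_power)
  also have "\<dots> = (\<Sum>z\<in>?B. \<Sum>w\<in>?B. \<Sum>S\<in>?B. complex_of_real (character S z * character S w) * (a z * cnj (a w)))"
    by (rule trans[OF sum.swap], rule sum.cong[OF refl], rule sum.swap)
  also have "\<dots> = (\<Sum>z\<in>?B. \<Sum>w\<in>?B. complex_of_real (if z = w then 2 ^ m else 0) * (a z * cnj (a w)))"
    by (intro sum.cong refl)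
      (simp only: character_orthogonal[symmetric] of_real_sum sum_distrib_right)
  also have "\<dots> = (\<Sum>z\<in>?B. \<Sum>w\<in>?B. if z = w then 2 ^ m * (a z * cnj (a w)) else 0)"
    by (intro sum.cong refl) auto
  also have "\<dots> = complex_of_real (2 ^ m * (\<Sum>z\<in>?B. (cmod (a z))\<^sup>2))"
    by (simp only: of_real_mult of_real_sum complex_norm_square sum_distrib_left) simp
  finally show ?thesis
    using of_real_eq_iff by blast
qed

lemma fourier_inversion:
  fixes a :: "bool list \<Rightarrow> complex"
  assumes z: "z \<in> bitstrings m"
  shows "(\<Sum>S\<in>bitstrings m. complex_of_real (character S z)
           * (\<Sum>w\<in>bitstrings m. complex_of_real (character S w) * a w)) = 2 ^ m * a z"
proof -
  let ?B = "bitstrings m"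
  have "(\<Sum>S\<in>?B. complex_of_real (character S z) * (\<Sum>w\<in>?B. complex_of_real (character S w) * a w))
      = (\<Sum>S\<in>?B. \<Sum>w\<in>?B. complex_of_real (character S z * character S w) * a w)"
    by (simp add: sum_distrib_left mult_ac)
  also have "\<dots> = (\<Sum>w\<in>?B. \<Sum>S\<in>?B. complex_of_real (character S z * character S w) * a w)"
    by (rule sum.swap)
  also have "\<dots> = (\<Sum>w\<in>?B. complex_of_real (if z = w then 2 ^ m else 0) * a w)"
    by (intro sum.cong refl)
      \<comment> \<open>Orthogonality is applied from right to left: the value \<open>2 ^ m\<close>
        or 0 is expanded back into the sum over \<open>S\<close>.\<close>
      (use z in \<open>simp only: character_orthogonal[symmetric] of_real_sum sum_distrib_right\<close>)
  also have "\<dots> = (\<Sum>w\<in>?B. if z = w then 2 ^ m * a w else 0)"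
    by (intro sum.cong refl) auto
  also have "\<dots> = 2 ^ m * a z"
    using z by simp
  finally show ?thesis .
qed

section \<open>Matrix-valued Fourier transform and the two bounds\<close>

definition mat_fourier :: "nat \<Rightarrow> nat \<Rightarrow> (bool list \<Rightarrow> complex mat) \<Rightarrow> bool list \<Rightarrow> complex mat" where
  "mat_fourier n m A S =
     mat n n (\<lambda>(i, j). \<Sum>z\<in>bitstrings m. complex_of_real (character S z) * A z $$ (i, j))"

text \<open>Balance kills the zero frequency, which is absent from the sum over nonzero
  \<open>S\<close> in the goal.\<close>

locale balanced_hermitian_family =
  fixes n m :: nat and A :: "bool list \<Rightarrow> complex mat"
  assumes carrier: "z \<in> bitstrings m \<Longrightarrow> A z \<in> carrier_mat n n"
    and herm: "z \<in> bitstrings m \<Longrightarrow> mat_adjoint (A z) = A z"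
    and balanced: "i < n \<Longrightarrow> j < n \<Longrightarrow> (\<Sum>z\<in>bitstrings m. A z $$ (i, j)) = 0"
begin

abbreviation nonzero :: "bool list set" where
  "nonzero \<equiv> bitstrings m - {replicate m False}"

abbreviation D :: "bool list \<Rightarrow> complex mat" where
  "D \<equiv> mat_fourier n m A"

lemma D_carrier: "D S \<in> carrier_mat n n"
  by (simp add: mat_fourier_def)

lemma D_herm: "mat_adjoint (D S) = D S"
  by (rule hermitianI[OF D_carrier])
    (use hermitian_index[OF herm carrier] in \<open>auto simp: mat_fourier_def intro!: sum.cong\<close>)

lemma D_zero: "i < n \<Longrightarrow> j < n \<Longrightarrow> D (replicate m False) $$ (i, j) = 0"
  by (simp add: mat_fourier_def balanced)

lemma sum_nonzero:
  assumes "f (replicate m False) = 0"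
  shows "(\<Sum>S\<in>nonzero. f S) = (\<Sum>S\<in>bitstrings m. f S)"
  using assms by (intro sum.mono_neutral_left) auto

text \<open>Fourier inversion writes \<open>A z\<close> as a combination of the \<open>D S\<close>
  with coefficients of modulus \<open>1 / 2 ^ m\<close>; the triangle inequality does the
  rest.\<close>

lemma tr_norm_le: "z \<in> bitstrings m \<Longrightarrow> 2 ^ m * tr_norm (A z) \<le> (\<Sum>S\<in>nonzero. tr_norm (D S))"
proof -
  assume z: "z \<in> bitstrings m"
  have "tr_norm (A z) \<le> (\<Sum>S\<in>nonzero. \<bar>character S z / 2 ^ m\<bar> * tr_norm (D S))"
  proof (rule tr_norm_sum_le[OF carrier[OF z] herm[OF z] D_carrier D_herm])
    fix i j assume ij: "i < n" "j < n"
    have "(\<Sum>S\<in>nonzero. complex_of_real (character S z / 2 ^ m) * D S $$ (i, j))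
        = (\<Sum>S\<in>bitstrings m. complex_of_real (character S z / 2 ^ m) * D S $$ (i, j))"
      by (rule sum_nonzero) (simp add: D_zero[OF ij])
    also have "\<dots> = (\<Sum>S\<in>bitstrings m. complex_of_real (character S z)
           * (\<Sum>w\<in>bitstrings m. complex_of_real (character S w) * A w $$ (i, j))) / 2 ^ m"
      using ij by (simp add: mat_fourier_def sum_divide_distrib)
    also have "\<dots> = A z $$ (i, j)"
      by (simp add: fourier_inversion[OF z])
    finally show "A z $$ (i, j) = (\<Sum>S\<in>nonzero. complex_of_real (character S z / 2 ^ m) * D S $$ (i, j))"
      by simp
  qed
  also have "\<dots> = (\<Sum>S\<in>nonzero. tr_norm (D S)) / 2 ^ m"
    by (simp add: sum_divide_distrib)
  finally show ?thesis
    by (simp add: field_simps)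
qed

lemma bound_bits:
  "(\<Sum>z\<in>bitstrings m. tr_norm (A z))\<^sup>2 \<le> 2 ^ m * (\<Sum>S\<in>nonzero. (tr_norm (D S))\<^sup>2)"
proof -
  have "(\<Sum>z\<in>bitstrings m. 2 ^ m * tr_norm (A z)) \<le> (\<Sum>z\<in>bitstrings m. \<Sum>S\<in>nonzero. tr_norm (D S))"
    by (intro sum_mono tr_norm_le)
  \<comment> \<open>The upper bound is the same for every \<open>z\<close>, so summing over all
    strings produces a factor \<open>2 ^ m\<close> that cancels.\<close>
  then have "2 ^ m * (\<Sum>z\<in>bitstrings m. tr_norm (A z)) \<le> 2 ^ m * (\<Sum>S\<in>nonzero. tr_norm (D S))"
    by (simp only: sum_distrib_left[symmetric] sum_constant card_bitstrings of_nat_power of_nat_numeral)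
  then have "(\<Sum>z\<in>bitstrings m. tr_norm (A z)) \<le> (\<Sum>S\<in>nonzero. tr_norm (D S))"
    by (simp del: sum_constant)
  then have "(\<Sum>z\<in>bitstrings m. tr_norm (A z))\<^sup>2 \<le> (\<Sum>S\<in>nonzero. tr_norm (D S))\<^sup>2"
    using tr_norm_nonneg[OF carrier herm] by (intro power_mono) (auto intro!: sum_nonneg)
  also have "\<dots> \<le> (\<Sum>S\<in>nonzero. (tr_norm (D S))\<^sup>2) * card nonzero"
    by (rule sum_squared_le_sum_of_squares)
  \<comment> \<open>Cauchy-Schwarz gives the number of nonzero strings, which is rounded up to
    \<open>2 ^ m\<close>.\<close>
  also have "\<dots> \<le> (\<Sum>S\<in>nonzero. (tr_norm (D S))\<^sup>2) * 2 ^ m"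
  proof (rule mult_left_mono)
    have "card nonzero \<le> 2 ^ m"
      using card_mono[of "bitstrings m" nonzero] by simp
    then show "real (card nonzero) \<le> 2 ^ m"
      using of_nat_mono[of "card nonzero" "2 ^ m", where ?'a = real] by simp
  qed (simp add: sum_nonneg)
  finally show ?thesis
    by (simp add: mult.commute)
qed

lemma hs_parseval: "2 ^ m * (\<Sum>z\<in>bitstrings m. hs_norm_sq n (A z)) = (\<Sum>S\<in>nonzero. hs_norm_sq n (D S))"
proof -
  have "(\<Sum>S\<in>nonzero. hs_norm_sq n (D S)) = (\<Sum>S\<in>bitstrings m. hs_norm_sq n (D S))"
    by (rule sum_nonzero) (simp add: hs_norm_sq_def D_zero)
  also have "\<dots> = (\<Sum>i<n. \<Sum>j<n. \<Sum>S\<in>bitstrings m. (cmod (D S $$ (i, j)))\<^sup>2)"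
    unfolding hs_norm_sq_def by (simp only: sum.swap[where A = "bitstrings m" and B = "{..<n}"])
  also have "\<dots> = (\<Sum>i<n. \<Sum>j<n. 2 ^ m * (\<Sum>z\<in>bitstrings m. (cmod (A z $$ (i, j)))\<^sup>2))"
    by (intro sum.cong refl) (simp add: mat_fourier_def fourier_parseval)
  also have "\<dots> = 2 ^ m * (\<Sum>z\<in>bitstrings m. hs_norm_sq n (A z))"
    unfolding hs_norm_sq_def
    by (simp only: sum.swap[where A = "bitstrings m" and B = "{..<n}"] sum_distrib_left)
  finally show ?thesis ..
qed

text \<open>Cauchy-Schwarz over \<open>z\<close> costs \<open>2 ^ m\<close> and passing to the
  Hilbert-Schmidt norm costs \<open>n\<close>. Parseval absorbs the \<open>2 ^ m\<close>, and the
  return to the trace norm is free.\<close>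

lemma bound_dim:
  "(\<Sum>z\<in>bitstrings m. tr_norm (A z))\<^sup>2 \<le> real n * (\<Sum>S\<in>nonzero. (tr_norm (D S))\<^sup>2)"
proof -
  \<comment> \<open>The norm comparison is stated for \<open>2 * tr_norm\<close>; the factor 4
    introduced here cancels at the end.\<close>
  have "4 * (\<Sum>z\<in>bitstrings m. tr_norm (A z))\<^sup>2 = (\<Sum>z\<in>bitstrings m. 2 * tr_norm (A z))\<^sup>2"
    by (simp only: power_mult_distrib sum_distrib_left[symmetric]) simp
  also have "\<dots> \<le> (\<Sum>z\<in>bitstrings m. (2 * tr_norm (A z))\<^sup>2) * card (bitstrings m)"
    by (rule sum_squared_le_sum_of_squares)
  also have "\<dots> \<le> (\<Sum>z\<in>bitstrings m. real n * hs_norm_sq n (A z)) * card (bitstrings m)"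
    by (intro mult_right_mono sum_mono tr_norm_hs_norm carrier herm) auto
  also have "\<dots> = real n * (2 ^ m * (\<Sum>z\<in>bitstrings m. hs_norm_sq n (A z)))"
    by (simp only: sum_distrib_left[symmetric] card_bitstrings) simp
  also have "\<dots> = real n * (\<Sum>S\<in>nonzero. hs_norm_sq n (D S))"
    by (simp add: hs_parseval)
  also have "\<dots> \<le> real n * (\<Sum>S\<in>nonzero. (2 * tr_norm (D S))\<^sup>2)"
    by (intro mult_left_mono sum_mono tr_norm_hs_norm D_carrier D_herm) auto
  also have "\<dots> = 4 * (real n * (\<Sum>S\<in>nonzero. (tr_norm (D S))\<^sup>2))"
    by (simp only: power_mult_distrib sum_distrib_left[symmetric]) simp
  finally show ?thesis by simp
qed

end

section \<open>Classical-quantum states\<close>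

lemma basis_proj_kron_index:
  assumes "\<sigma> \<in> carrier_mat n n" "length u = k" "i < 2 ^ k * n" "j < 2 ^ k * n"
  shows "(basis_proj u \<otimes>\<^sub>m \<sigma>) $$ (i, j)
    = of_bool (i div n = bits_value u \<and> j div n = bits_value u) * \<sigma> $$ (i mod n, j mod n)"
  using assms div_mod_bounds[OF assms(3)] div_mod_bounds[OF assms(4)]
  by (auto simp: basis_proj_def kron_def bits_value_def Let_def)

lemma basis_proj_kron_dims [simp]:
  "dim_row (basis_proj u \<otimes>\<^sub>m \<sigma>) = 2 ^ length u * dim_row \<sigma>"
  "dim_col (basis_proj u \<otimes>\<^sub>m \<sigma>) = 2 ^ length u * dim_col \<sigma>"
  by (simp_all add: kron_def basis_proj_def Let_def)

text \<open>Exactly one string of length \<open>m\<close> has value \<open>k\<close>, so at most one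
  projector contributes. This turns sums of projectors into blocks.\<close>

lemma sum_select_bits:
  fixes f :: "bool list \<Rightarrow> complex"
  assumes "k < 2 ^ m"
  shows "(\<Sum>z\<in>bitstrings m. of_bool (k = bits_value z \<and> l = bits_value z) * f z)
    = (if k = l then f (inv_into (bitstrings m) bits_value k) else 0)"
proof -
  let ?z = "inv_into (bitstrings m) bits_value k"
  have z: "?z \<in> bitstrings m" "bits_value ?z = k"
    using assms bits_value_bij[of m] bij_betw_inv_into_right[of bits_value "bitstrings m" "{..<2 ^ m}" k]
      bij_betwE[OF bij_betw_inv_into, of bits_value "bitstrings m" "{..<2 ^ m}"] by auto
  have "k = bits_value w \<longleftrightarrow> w = ?z" if "w \<in> bitstrings m" for w
    using that z bits_value_bij[of m] by (auto simp: bij_betw_def inj_on_def)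
  then have "(\<Sum>w\<in>bitstrings m. of_bool (k = bits_value w \<and> l = bits_value w) * f w)
      = (\<Sum>w\<in>bitstrings m. if w = ?z then (if k = l then f ?z else 0) else 0)"
    using z by (intro sum.cong refl) auto
  then show ?thesis
    using z by simp
qed

lemma uniform_state_eq:
  assumes \<sigma>: "\<sigma> \<in> carrier_mat n n"
  shows "uniform_state n k \<sigma> = block_diag (2 ^ k) n (\<lambda>_. complex_of_real (1 / 2 ^ k) \<cdot>\<^sub>m \<sigma>)"
proof (rule eq_matI)
  fix i j assume "i < dim_row (block_diag (2 ^ k) n (\<lambda>_. complex_of_real (1 / 2 ^ k) \<cdot>\<^sub>m \<sigma>))"
    "j < dim_col (block_diag (2 ^ k) n (\<lambda>_. complex_of_real (1 / 2 ^ k) \<cdot>\<^sub>m \<sigma>))"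
  then have ij: "i < 2 ^ k * n" "j < 2 ^ k * n" by auto
  note b = div_mod_bounds[OF ij(1)] div_mod_bounds[OF ij(2)]
  have "(\<Sum>u\<in>bitstrings k. (basis_proj u \<otimes>\<^sub>m \<sigma>) $$ (i, j))
      = (\<Sum>u\<in>bitstrings k. of_bool (i div n = bits_value u \<and> j div n = bits_value u) * \<sigma> $$ (i mod n, j mod n))"
    by (intro sum.cong refl basis_proj_kron_index[OF \<sigma>]) (use ij in \<open>auto simp: bitstrings_def\<close>)
  also have "\<dots> = (if i div n = j div n then \<sigma> $$ (i mod n, j mod n) else 0)"
    by (rule sum_select_bits[OF b(1)])
  finally show "uniform_state n k \<sigma> $$ (i, j)
      = block_diag (2 ^ k) n (\<lambda>_. complex_of_real (1 / 2 ^ k) \<cdot>\<^sub>m \<sigma>) $$ (i, j)"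
    using ij b \<sigma> by (simp add: uniform_state_def mat_sum_def block_diag_def)
qed (simp_all add: uniform_state_def mat_sum_def)

lemma block_diag_minus:
  assumes "\<And>k. k < K \<Longrightarrow> F k \<in> carrier_mat n n" "\<And>k. k < K \<Longrightarrow> G k \<in> carrier_mat n n"
  shows "block_diag K n F - block_diag K n G = block_diag K n (\<lambda>k. F k - G k)"
proof (rule eq_matI)
  fix i j assume "i < dim_row (block_diag K n (\<lambda>k. F k - G k))" "j < dim_col (block_diag K n (\<lambda>k. F k - G k))"
  then have ij: "i < K * n" "j < K * n" by auto
  note b = div_mod_bounds[OF ij(1)] div_mod_bounds[OF ij(2)]
  show "(block_diag K n F - block_diag K n G) $$ (i, j) = block_diag K n (\<lambda>k. F k - G k) $$ (i, j)"
    using ij b assms[OF b(1)] assms[OF b(3)] by (auto simp: block_diag_def)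
qed auto

locale cq_family =
  fixes n m :: nat and p :: "bool list \<Rightarrow> real" and \<rho> :: "bool list \<Rightarrow> complex mat"
  assumes \<rho>_carrier: "z \<in> bitstrings m \<Longrightarrow> \<rho> z \<in> carrier_mat n n"
    and \<rho>_herm: "z \<in> bitstrings m \<Longrightarrow> mat_adjoint (\<rho> z) = \<rho> z"
begin

abbreviation \<sigma> :: "complex mat" where
  "\<sigma> \<equiv> avg_state n m p \<rho>"

text \<open>The block at \<open>z\<close> of the difference on the left-hand side of the theorem.
  Subtracting equal shares of the average makes the family sum to zero.\<close>

definition A :: "bool list \<Rightarrow> complex mat" where
  "A z = complex_of_real (p z) \<cdot>\<^sub>m \<rho> z - complex_of_real (1 / 2 ^ m) \<cdot>\<^sub>m \<sigma>"

lemma \<sigma>_carrier: "\<sigma> \<in> carrier_mat n n"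
  by (simp add: avg_state_def mat_sum_def)

lemma \<sigma>_index:
  "i < n \<Longrightarrow> j < n \<Longrightarrow> \<sigma> $$ (i, j) = (\<Sum>z\<in>bitstrings m. complex_of_real (p z) * \<rho> z $$ (i, j))"
  using carrier_matD[OF \<rho>_carrier] by (auto simp: avg_state_def mat_sum_def intro!: sum.cong)

lemma A_index:
  "z \<in> bitstrings m \<Longrightarrow> i < n \<Longrightarrow> j < n \<Longrightarrow>
    A z $$ (i, j) = complex_of_real (p z) * \<rho> z $$ (i, j) - \<sigma> $$ (i, j) / 2 ^ m"
  using \<rho>_carrier[of z] \<sigma>_carrier by (simp add: A_def)

sublocale balanced_hermitian_family n m A
proof
  fix z assume z: "z \<in> bitstrings m"
  show Ac: "A z \<in> carrier_mat n n"
    using \<rho>_carrier[OF z] \<sigma>_carrier by (auto simp: A_def)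
  show "mat_adjoint (A z) = A z"
    by (rule hermitianI[OF Ac])
      (use z hermitian_index[OF \<rho>_herm \<rho>_carrier] in \<open>auto simp: A_index \<sigma>_index intro!: sum.cong\<close>)
next
  fix i j assume "i < n" "j < n"
  then show "(\<Sum>z\<in>bitstrings m. A z $$ (i, j)) = 0"
    by (simp add: A_index sum_subtractf \<sigma>_index)
qed

text \<open>The share of \<open>\<sigma>\<close> in \<open>A z\<close> is the same for every
  \<open>z\<close>, and a nonzero character sums to zero.\<close>

lemma D_index:
  assumes "S \<in> nonzero" "i < n" "j < n"
  shows "D S $$ (i, j) = (\<Sum>z\<in>bitstrings m. complex_of_real (character S z) * (complex_of_real (p z) * \<rho> z $$ (i, j)))"
proof -
  have "D S $$ (i, j) = (\<Sum>z\<in>bitstrings m. complex_of_real (character S z) * (complex_of_real (p z) * \<rho> z $$ (i, j)))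
      - complex_of_real (\<Sum>z\<in>bitstrings m. character S z) * (\<sigma> $$ (i, j) / 2 ^ m)"
    using assms by (simp add: mat_fourier_def A_index right_diff_distrib sum_subtractf flip: sum_distrib_right sum_divide_distrib)
  moreover have "complex_of_real (\<Sum>z\<in>bitstrings m. character S z) = 0"
    using assms character_sum_zero[of S m] by simp
  ultimately show ?thesis
    by (simp only: mult_zero_left diff_zero)
qed

lemma cq_state_eq:
  "cq_state n m p \<rho> = block_diag (2 ^ m) n
     (\<lambda>k. let z = inv_into (bitstrings m) bits_value k in complex_of_real (p z) \<cdot>\<^sub>m \<rho> z)"
    (is "_ = block_diag _ _ ?F")
proof (rule eq_matI)
  fix i j assume "i < dim_row (block_diag (2 ^ m) n ?F)" "j < dim_col (block_diag (2 ^ m) n ?F)"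
  then have ij: "i < 2 ^ m * n" "j < 2 ^ m * n" by auto
  note b = div_mod_bounds[OF ij(1)] div_mod_bounds[OF ij(2)]
  have z: "inv_into (bitstrings m) bits_value (i div n) \<in> bitstrings m"
    using b(1) bij_betwE[OF bij_betw_inv_into[OF bits_value_bij[of m]]] by auto
  have entry: "(complex_of_real (p w) \<cdot>\<^sub>m (basis_proj w \<otimes>\<^sub>m \<rho> w)) $$ (i, j)
      = of_bool (i div n = bits_value w \<and> j div n = bits_value w) * (complex_of_real (p w) * \<rho> w $$ (i mod n, j mod n))"
    if w: "w \<in> bitstrings m" for w
    using basis_proj_kron_index[OF \<rho>_carrier[OF w], of w m i j] carrier_matD[OF \<rho>_carrier[OF w]] ij w
    by (simp add: bitstrings_def)
  have "cq_state n m p \<rho> $$ (i, j) = (\<Sum>z\<in>bitstrings m.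
      of_bool (i div n = bits_value z \<and> j div n = bits_value z) * (complex_of_real (p z) * \<rho> z $$ (i mod n, j mod n)))"
    using ij by (simp add: cq_state_def mat_sum_def entry)
  also have "\<dots> = block_diag (2 ^ m) n ?F $$ (i, j)"
    unfolding sum_select_bits[OF b(1)] using b ij carrier_matD[OF \<rho>_carrier[OF z]]
    by (cases "i div n = j div n") (simp_all add: block_diag_def Let_def)
  finally show "cq_state n m p \<rho> $$ (i, j) = block_diag (2 ^ m) n ?F $$ (i, j)" .
qed (simp_all add: cq_state_def mat_sum_def)

text \<open>The trace norm is additive over blocks, and the inverse of \<open>bits_value\<close>
  converts block numbers into strings.\<close>

lemma tr_norm_cq:
  "tr_norm (cq_state n m p \<rho> - uniform_state n m \<sigma>) = (\<Sum>z\<in>bitstrings m. tr_norm (A z))"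
proof -
  let ?z = "inv_into (bitstrings m) bits_value"
  note bij = bij_betw_inv_into[OF bits_value_bij[of m]]
  have z: "?z k \<in> bitstrings m" if "k < 2 ^ m" for k
    using that bij_betwE[OF bij] by auto
  have "cq_state n m p \<rho> - uniform_state n m \<sigma> = block_diag (2 ^ m) n (\<lambda>k. A (?z k))"
    unfolding cq_state_eq uniform_state_eq[OF \<sigma>_carrier] A_def Let_def
    by (rule block_diag_minus) (use z \<rho>_carrier \<sigma>_carrier in auto)
  then have "tr_norm (cq_state n m p \<rho> - uniform_state n m \<sigma>) = (\<Sum>k<2 ^ m. tr_norm (A (?z k)))"
    using z carrier herm by (simp add: tr_norm_block_diag)
  also have "\<dots> = (\<Sum>z\<in>bitstrings m. tr_norm (A z))"
    by (rule sum.reindex_bij_betw[OF bij])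
  finally show ?thesis .
qed

lemma dot_state_index:
  assumes ij: "i < 2 * n" "j < 2 * n"
  shows "dot_state n m S p \<rho> $$ (i, j) = (if i div n = j div n
    then \<Sum>z\<in>bitstrings m. of_bool (i div n = of_bool (bit_dot S z)) * (complex_of_real (p z) * \<rho> z $$ (i mod n, j mod n))
    else 0)"
proof -
  have "(complex_of_real (p z) \<cdot>\<^sub>m (basis_proj [bit_dot S z] \<otimes>\<^sub>m \<rho> z)) $$ (i, j)
      = (if i div n = j div n
         then of_bool (i div n = of_bool (bit_dot S z)) * (complex_of_real (p z) * \<rho> z $$ (i mod n, j mod n))
         else 0)" if z: "z \<in> bitstrings m" for z
    using \<rho>_carrier[OF z] ij basis_proj_kron_index[OF \<rho>_carrier[OF z], of "[bit_dot S z]" 1 i j]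
    by (auto simp: bits_value_def)
  then show ?thesis
    using ij by (simp add: dot_state_def mat_sum_def)
qed

text \<open>The two blocks \<open>F 0\<close> and \<open>F 1\<close> of the difference are half of
  \<open>D S\<close> and its negative. Writing \<open>D S\<close> as \<open>F 0 - F 1\<close> and
  using the triangle inequality gives the direction wanted, without a separate scaling law.\<close>

lemma tr_norm_dot:
  assumes S: "S \<in> nonzero"
  shows "tr_norm (D S) \<le> tr_norm (dot_state n m S p \<rho> - uniform_state n 1 \<sigma>)"
proof -
  define F where "F k = complex_of_real (if k = 0 then 1 / 2 else - 1 / 2) \<cdot>\<^sub>m D S" for k :: nat
  have Fc: "F k \<in> carrier_mat n n" for k
    using D_carrier by (simp add: F_def)
  have Fh: "mat_adjoint (F k) = F k" for k
    by (rule hermitianI[OF Fc])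
      (use hermitian_index[OF D_herm D_carrier] carrier_matD[OF D_carrier] in \<open>auto simp: F_def\<close>)
  have "dot_state n m S p \<rho> - uniform_state n 1 \<sigma> = block_diag 2 n F"
  proof (rule eq_matI)
    fix i j assume "i < dim_row (block_diag 2 n F)" "j < dim_col (block_diag 2 n F)"
    then have ij: "i < 2 * n" "j < 2 * n" by auto
    note b = div_mod_bounds[OF ij(1)] div_mod_bounds[OF ij(2)]
    let ?r = "\<lambda>z. complex_of_real (p z) * \<rho> z $$ (i mod n, j mod n)"
    have sel: "(\<Sum>z\<in>bitstrings m. of_bool (i div n = of_bool (bit_dot S z)) * ?r z) - \<sigma> $$ (i mod n, j mod n) / 2
        = F (i div n) $$ (i mod n, j mod n)"
    proof -
      have "(\<Sum>z\<in>bitstrings m. of_bool (i div n = of_bool (bit_dot S z)) * ?r z) - \<sigma> $$ (i mod n, j mod n) / 2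
          = (\<Sum>z\<in>bitstrings m. of_bool (i div n = of_bool (bit_dot S z)) * ?r z - ?r z / 2)"
        using b by (simp add: \<sigma>_index sum_subtractf sum_divide_distrib)
      \<comment> \<open>The indicator of one value of \<open>S \<cdot> z\<close>, minus one half, is
        half the character up to a sign depending on the block.\<close>
      also have "\<dots> = (\<Sum>z\<in>bitstrings m. complex_of_real (if i div n = 0 then 1 / 2 else - 1 / 2)
          * (complex_of_real (character S z) * ?r z))"
        using b(1) by (intro sum.cong refl) (auto simp: character_def less_2_cases_iff)
      also have "\<dots> = F (i div n) $$ (i mod n, j mod n)"
        using b S carrier_matD[OF D_carrier] by (simp add: F_def D_index sum_distrib_left)
      finally show ?thesis .
    qed
    have "(dot_state n m S p \<rho> - uniform_state n 1 \<sigma>) $$ (i, j) = dot_state n m S p \<rho> $$ (i, j)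
        - (if i div n = j div n then \<sigma> $$ (i mod n, j mod n) / 2 else 0)"
      using ij b carrier_matD[OF \<sigma>_carrier]
      by (simp add: uniform_state_eq[OF \<sigma>_carrier] block_diag_def)
    also have "\<dots> = (if i div n = j div n then F (i div n) $$ (i mod n, j mod n) else 0)"
      unfolding dot_state_index[OF ij] sel[symmetric] by simp
    also have "\<dots> = block_diag 2 n F $$ (i, j)"
      using ij by (simp add: block_diag_def)
    finally show "(dot_state n m S p \<rho> - uniform_state n 1 \<sigma>) $$ (i, j) = block_diag 2 n F $$ (i, j)" .
  qed (simp_all add: uniform_state_eq[OF \<sigma>_carrier])
  then have "tr_norm (dot_state n m S p \<rho> - uniform_state n 1 \<sigma>) = (\<Sum>k<2. tr_norm (F k))"
    using Fc Fh by (simp add: tr_norm_block_diag)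
  moreover have "tr_norm (D S) \<le> (\<Sum>k<2. \<bar>if k = 0 then 1 else - 1\<bar> * tr_norm (F k))"
    by (rule tr_norm_sum_le[OF D_carrier D_herm Fc Fh])
      (use carrier_matD[OF D_carrier] in \<open>simp add: F_def numeral_2_eq_2\<close>)
  ultimately show ?thesis
    by (simp add: numeral_2_eq_2)
qed

end

theorem lemma10:
  fixes M :: "'w measure" and Z :: "'w \<Rightarrow> bool list"
    and m d :: nat and \<rho> :: "bool list \<Rightarrow> complex mat" and p :: "bool list \<Rightarrow> real"
  assumes "prob_space M"
    and "Z \<in> measurable M (count_space (bitstrings m))"
    and "\<And>z. z \<in> bitstrings m \<Longrightarrow> density_mat (2 ^ d) (\<rho> z)"
    and p_def: "\<And>z. p z = measure M {\<omega> \<in> space M. Z \<omega> = z}"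
  shows "(tr_norm (cq_state (2 ^ d) m p \<rho> -
                   uniform_state (2 ^ d) m (avg_state (2 ^ d) m p \<rho>)))\<^sup>2
         \<le> 2 ^ min d m *
           (\<Sum>S \<in> bitstrings m - {replicate m False}.
              (tr_norm (dot_state (2 ^ d) m S p \<rho> -
                        uniform_state (2 ^ d) 1 (avg_state (2 ^ d) m p \<rho>)))\<^sup>2)"
proof -
  interpret cq_family "2 ^ d" m p \<rho>
    by unfold_locales (use assms(3) in \<open>auto simp: density_mat_def psd_mat_def\<close>)
  \<comment> \<open>For \<open>d \<le> m\<close> the dimension bound applies with
    \<open>n = 2 ^ d\<close>; otherwise the bound with factor \<open>2 ^ m\<close> does.\<close>
  have "(\<Sum>z\<in>bitstrings m. tr_norm (A z))\<^sup>2 \<le> 2 ^ min d m * (\<Sum>S\<in>nonzero. (tr_norm (D S))\<^sup>2)"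
    using bound_bits bound_dim by (simp add: min_def)
  also have "\<dots> \<le> 2 ^ min d m * (\<Sum>S\<in>nonzero.
      (tr_norm (dot_state (2 ^ d) m S p \<rho> - uniform_state (2 ^ d) 1 \<sigma>))\<^sup>2)"
    by (intro mult_left_mono sum_mono power_mono tr_norm_dot tr_norm_nonneg[OF D_carrier D_herm]) auto
  finally show ?thesis
    by (simp add: tr_norm_cq)
qed

end
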